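(* Let $(\Omega,\Omega^\Omega,\mathcal B_\Omega,\mathsf P)$ be a sample space with product-compatible probability measures and assume that there is an isomorphism of quasi-measurable spaces $\Omega\cong\Omega\times\Omega$. Let $(\mathcal X,\mathcal X^\Omega)$, $(\mathcal Y,\mathcal Y^\Omega)$, $(\mathcal Z,\mathcal Z^\Omega)$ be any quasi-measurable spaces. Then the product of Markov kernels $$\otimes:\ \mathsf P(\mathcal X)^{\mathcal Y\times\mathcal Z}\times\mathsf P(\mathcal Y)^{\mathcal Z}\to\mathsf P(\mathcal X\times\mathcal Y)^{\mathcal Z},$$ given for $D\in\mathcal B_{\mathcal X\times\mathcal Y}$ and $z\in\mathcal Z$ by $$\bigl(K(X|Y,Z)\otimes Q(Y|Z)\bigr)(D|z):=\int K(X\in D^y|Y=y,Z=z)\,Q(Y\in dy|Z=z),$$ is a well-defined and quasi-measurable map.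
   Context: Sample space: $\Omega$ is a non-empty set; $\Omega^\Omega$ is a set of maps $\Omega\to\Omega$ containing the identity and all constant maps and closed under composition; $\mathcal B_\Omega$ is a $\sigma$-algebra on $\Omega$ such that every $\Phi\in\Omega^\Omega$ is $\mathcal B_\Omega$-$\mathcal B_\Omega$-measurable. A quasi-measurable space is a pair $(\mathcal X,\mathcal X^\Omega)$ of a set and a set $\mathcal X^\Omega$ of maps $\Omega\to\mathcal X$ (admissible random variables) containing all constant maps and closed under $X\mapsto X\circ\Phi$, $\Phi\in\Omega^\Omega$. A map $g:\mathcal X\to\mathcal Y$ is quasi-measurable if $g\circ X\in\mathcal Y^\Omega$ for all $X\in\mathcal X^\Omega$. The product is $(\mathcal X\times\mathcal Y,\mathcal X^\Omega\times\mathcal Y^\Omega)$. The function space $\mathcal Y^{\mathcal X}$ is the set of quasi-measurable maps $\mathcal X\to\mathcal Y$, whose admissible random variables $(\mathcal Y^{\mathcal X})^\Omega$ are the maps $Y:\Omega\to\mathcal Y^{\mathcal X}$ for which $(\omega,x)\mapsto Y(\omega)(x)$ is quasi-measurable $\Omega\times\mathcal X\to\mathcal Y$. (For $\mathcal X=\Omega$ this agrees with the notation $\mathcal Y^\Omega$.) The induced $\sigma$-algebra is $\mathcal B_{\mathcal X}=\{A\subseteq\mathcal X\mid X^{-1}(A)\in\mathcal B_\Omega\ \forall X\in\mathcal X^\Omega\}$; $\mathcal B_{\mathcal X\times\mathcal Y}$ is the induced $\sigma$-algebra of the product quasi-measurable space. For $D\subseteq\mathcal X\times\mathcal Y$, $D^y=\{x\mid(x,y)\in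 D\}$. Product-compatible probability measures: $\mathsf P$ is a non-empty set of probability measures $P:\mathcal B_P\to[0,1]$ on $\Omega$, each with its own $\sigma$-algebra $\mathcal B_P$ as domain, such that: (i) for all $\Phi\in\Omega^\Omega$, $P\in\mathsf P$, $D\in\mathcal B_\Omega$: $\Phi^{-1}(D)\in\mathcal B_P$; (ii) for all $D\in\mathcal B_{\Omega\times\Omega}$ and $P\in\mathsf P$ the map $\omega\mapsto P(D^\omega)$ is $\mathcal B_\Omega$-measurable; (iii) for all $P_1,P_2\in\mathsf P$ there are $P\in\mathsf P$ and $\Phi=(\Phi_1,\Phi_2)$ with $\Phi_1,\Phi_2\in\Omega^\Omega$ such that for all $D\in\mathcal B_{\Omega\times\Omega}$: $\int P_1(D^{\omega_2})\,P_2(d\omega_2)=P(\Phi^{-1}(D))$. The quasi-measurable space $\mathsf P(\mathcal X)$: its elements are the push-forward measures $P(X):\mathcal B_{\mathcal X}\to[0,1]$, $A\mapsto P(X^{-1}(A))$, with $P\in\mathsf P$, $X\in\mathcal X^\Omega$; its admissible random variables are the maps $\omega\mapsto\bigl(A\mapsto P(X(\omega)^{-1}(A))\bigr)$ with $P\in\mathsf P$ and $X\in(\mathcal X^\Omega)^\Omega$. For $K\in\mathsf P(\mathcal X)^{\mathcal Z}$ one writes $K(X\in A|Z=z)=K(z)(A)$. *)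

theory Defs
  imports "HOL-Probability.Probability" "HOL-Library.FuncSet"
begin

text \<open>
  Points of a space form a carrier set, and a map between carriers is represented by its
  extensional HOL function (\<open>\<rightarrow>\<^sub>E\<close>), so that equal maps are equal as HOL terms.
  The first type parameter is the ambient type of the sample space.
\<close>

record ('w, 'x) qms =
  points :: "'x set"
  rvs :: "('w \<Rightarrow> 'x) set"

text \<open>
  The sample space \<open>(\<Omega>, \<Omega>\<^sup>\<Omega>, \<B>\<^sub>\<Omega>)\<close> is given by \<open>Om\<close>, holding \<open>\<Omega>\<close> and \<open>\<Omega>\<^sup>\<Omega>\<close>, and by
  \<open>B\<close>, of which only \<open>space B\<close> and \<open>sets B\<close> matter.
\<close>

locale sample_space =
  fixes Om :: "('w, 'w) qms" and B :: "'w measure"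
  assumes nonempty: "points Om \<noteq> {}"
    and maps: "rvs Om \<subseteq> points Om \<rightarrow>\<^sub>E points Om"
    and ident: "(\<lambda>\<omega>\<in>points Om. \<omega>) \<in> rvs Om"
    and const: "\<And>c. c \<in> points Om \<Longrightarrow> (\<lambda>\<omega>\<in>points Om. c) \<in> rvs Om"
    and comp: "\<And>\<Phi> \<Psi>. \<Phi> \<in> rvs Om \<Longrightarrow> \<Psi> \<in> rvs Om \<Longrightarrow> compose (points Om) \<Phi> \<Psi> \<in> rvs Om"
    and space_B: "space B = points Om"
    and measurable: "\<And>\<Phi>. \<Phi> \<in> rvs Om \<Longrightarrow> \<Phi> \<in> measurable B B"

locale quasi_measurable_space =
  fixes Om :: "('w, 'w) qms" and X :: "('w, 'x) qms"
  assumes maps: "rvs X \<subseteq> points Om \<rightarrow>\<^sub>E points X"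
    and const: "\<And>x. x \<in> points X \<Longrightarrow> (\<lambda>\<omega>\<in>points Om. x) \<in> rvs X"
    and comp: "\<And>\<xi> \<Phi>. \<xi> \<in> rvs X \<Longrightarrow> \<Phi> \<in> rvs Om \<Longrightarrow> compose (points Om) \<xi> \<Phi> \<in> rvs X"

definition qm_maps :: "('w, 'w) qms \<Rightarrow> ('w, 'x) qms \<Rightarrow> ('w, 'y) qms \<Rightarrow> ('x \<Rightarrow> 'y) set" where
  "qm_maps Om X Y =
     {g \<in> points X \<rightarrow>\<^sub>E points Y. \<forall>\<xi>\<in>rvs X. compose (points Om) g \<xi> \<in> rvs Y}"

definition qm_isomorphic :: "('w, 'w) qms \<Rightarrow> ('w, 'x) qms \<Rightarrow> ('w, 'y) qms \<Rightarrow> bool" where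
  "qm_isomorphic Om X Y \<longleftrightarrow>
     (\<exists>f\<in>qm_maps Om X Y. \<exists>g\<in>qm_maps Om Y X.
        (\<forall>x\<in>points X. g (f x) = x) \<and> (\<forall>y\<in>points Y. f (g y) = y))"

definition qm_prod :: "('w, 'w) qms \<Rightarrow> ('w, 'x) qms \<Rightarrow> ('w, 'y) qms \<Rightarrow> ('w, 'x \<times> 'y) qms" where
  "qm_prod Om X Y =
     \<lparr>points = points X \<times> points Y,
      rvs = {\<lambda>\<omega>\<in>points Om. (\<xi> \<omega>, \<eta> \<omega>) | \<xi> \<eta>. \<xi> \<in> rvs X \<and> \<eta> \<in> rvs Y}\<rparr>"

text \<open>
  \<open>qm_fun Om X Y\<close> is \<open>Y\<^sup>X\<close>: the exponent comes first.
\<close>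

definition qm_fun :: "('w, 'w) qms \<Rightarrow> ('w, 'x) qms \<Rightarrow> ('w, 'y) qms \<Rightarrow> ('w, 'x \<Rightarrow> 'y) qms" where
  "qm_fun Om X Y =
     \<lparr>points = qm_maps Om X Y,
      rvs = {F \<in> points Om \<rightarrow>\<^sub>E qm_maps Om X Y.
              (\<lambda>(\<omega>, x)\<in>points Om \<times> points X. F \<omega> x) \<in> qm_maps Om (qm_prod Om Om X) Y}\<rparr>"

text \<open>
  The induced \<open>\<sigma>\<close>-algebra \<open>\<B>\<^sub>X\<close>, packaged as a measurable space. The generating family is
  already a \<open>\<sigma>\<close>-algebra; see \<open>sets_qm_sigma\<close> below.
\<close>

definition qm_sigma :: "'w measure \<Rightarrow> ('w, 'x) qms \<Rightarrow> 'x measure" where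
  "qm_sigma B X =
     sigma (points X) {A. A \<subseteq> points X \<and> (\<forall>\<xi>\<in>rvs X. \<xi> -` A \<inter> space B \<in> sets B)}"

lemma space_qm_sigma: "space (qm_sigma B X) = points X"
  by (auto simp: qm_sigma_def intro!: space_measure_of)

lemma sets_qm_sigma:
  assumes "rvs X \<subseteq> space B \<rightarrow>\<^sub>E points X"
  shows "sets (qm_sigma B X) =
    {A. A \<subseteq> points X \<and> (\<forall>\<xi>\<in>rvs X. \<xi> -` A \<inter> space B \<in> sets B)}" (is "_ = ?S")
proof -
  have "sigma_algebra (points X) ?S"
  proof (rule sigma_algebra_iff2[THEN iffD2], intro conjI ballI allI impI)
    fix A assume A: "A \<in> ?S"
    have "\<xi> -` (points X - A) \<inter> space B = space B - (\<xi> -` A \<inter> space B)" if "\<xi> \<in> rvs X" for \<xi>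
      using assms that by fastforce
    with A show "points X - A \<in> ?S" by auto
  next
    fix A :: "nat \<Rightarrow> _" assume A: "range A \<subseteq> ?S"
    have "\<xi> -` (\<Union>i. A i) \<inter> space B = (\<Union>i. \<xi> -` A i \<inter> space B)" for \<xi>
      by auto
    with A show "(\<Union>i. A i) \<in> ?S"
      by (auto simp only: mem_Collect_eq image_subset_iff UN_subset_iff intro!: sets.countable_UN)
  qed auto
  then show ?thesis
    unfolding qm_sigma_def by (simp add: sigma_algebra.sets_measure_of_eq)
qed

text \<open>
  Each \<open>P \<in> Ps\<close> carries its own \<open>\<sigma>\<close>-algebra \<open>sets P\<close>. The section \<open>D\<^sup>\<omega>\<close> of
  \<open>D \<subseteq> X \<times> Y\<close> fixes the second coordinate.
\<close>

definition section_at :: "('x \<times> 'y) set \<Rightarrow> 'y \<Rightarrow> 'x set" where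
  "section_at D y = {x. (x, y) \<in> D}"

locale product_compatible = sample_space Om B
  for Om :: "('w, 'w) qms" and B :: "'w measure" +
  fixes Ps :: "'w measure set"
  assumes Ps_nonempty: "Ps \<noteq> {}"
    and prob: "\<And>P. P \<in> Ps \<Longrightarrow> prob_space P \<and> space P = points Om"
    and vimage_sets: "\<And>\<Phi> P D. \<Phi> \<in> rvs Om \<Longrightarrow> P \<in> Ps \<Longrightarrow> D \<in> sets B \<Longrightarrow>
      \<Phi> -` D \<inter> points Om \<in> sets P"
    and measurable_section: "\<And>D P. D \<in> sets (qm_sigma B (qm_prod Om Om Om)) \<Longrightarrow> P \<in> Ps \<Longrightarrow>
      (\<lambda>\<omega>. emeasure P (section_at D \<omega>)) \<in> borel_measurable B"
    and product: "\<And>P1 P2. P1 \<in> Ps \<Longrightarrow> P2 \<in> Ps \<Longrightarrow>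
      \<exists>P\<in>Ps. \<exists>\<Phi>1\<in>rvs Om. \<exists>\<Phi>2\<in>rvs Om. \<forall>D\<in>sets (qm_sigma B (qm_prod Om Om Om)).
        (\<integral>\<^sup>+\<omega>2. emeasure P1 (section_at D \<omega>2) \<partial>P2) =
        emeasure P {\<omega>\<in>points Om. (\<Phi>1 \<omega>, \<Phi>2 \<omega>) \<in> D}"

text \<open>
  The space \<open>\<P>(X)\<close>; \<open>distr P (qm_sigma B X) \<xi>\<close> is the push-forward of \<open>P\<close> along \<open>\<xi>\<close> with
  domain \<open>\<B>\<^sub>X\<close>, and \<open>rvs (qm_fun Om Om X)\<close> is \<open>(X\<^sup>\<Omega>)\<^sup>\<Omega>\<close>.
\<close>

definition qm_prob ::
  "('w, 'w) qms \<Rightarrow> 'w measure \<Rightarrow> 'w measure set \<Rightarrow> ('w, 'x) qms \<Rightarrow> ('w, 'x measure) qms" where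
  "qm_prob Om B Ps X =
     \<lparr>points = {distr P (qm_sigma B X) \<xi> | P \<xi>. P \<in> Ps \<and> \<xi> \<in> rvs X},
      rvs = {\<lambda>\<omega>\<in>points Om. distr P (qm_sigma B X) (F \<omega>) | P F.
              P \<in> Ps \<and> F \<in> rvs (qm_fun Om Om X)}\<rparr>"

definition kernels ::
  "('w, 'w) qms \<Rightarrow> 'w measure \<Rightarrow> 'w measure set \<Rightarrow> ('w, 'x) qms \<Rightarrow> ('w, 'z) qms \<Rightarrow>
   ('w, 'z \<Rightarrow> 'x measure) qms" where
  "kernels Om B Ps X Z = qm_fun Om Z (qm_prob Om B Ps X)"

text \<open>
  The set function \<open>D \<mapsto> (K \<otimes> Q)(D|z)\<close>. Since \<open>measure_of\<close> replaces a set function that is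
  not a measure by 0, the measure built from it has the prescribed values only once the latter
  is shown to be a measure.
\<close>

definition kernel_prod_val ::
  "('y \<times> 'z \<Rightarrow> 'x measure) \<Rightarrow> ('z \<Rightarrow> 'y measure) \<Rightarrow> 'z \<Rightarrow> ('x \<times> 'y) set \<Rightarrow> ennreal" where
  "kernel_prod_val K Q z D = (\<integral>\<^sup>+y. emeasure (K (y, z)) (section_at D y) \<partial>Q z)"

definition kernel_prod ::
  "('w, 'w) qms \<Rightarrow> 'w measure \<Rightarrow> ('w, 'x) qms \<Rightarrow> ('w, 'y) qms \<Rightarrow> ('w, 'z) qms \<Rightarrow>
   ('y \<times> 'z \<Rightarrow> 'x measure) \<Rightarrow> ('z \<Rightarrow> 'y measure) \<Rightarrow> 'z \<Rightarrow> ('x \<times> 'y) measure" where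
  "kernel_prod Om B X Y Z K Q =
     (\<lambda>z\<in>points Z. measure_of (points X \<times> points Y) (sets (qm_sigma B (qm_prod Om X Y)))
        (kernel_prod_val K Q z))"

end

theory Submission
  imports Defs
begin

text \<open>
  Let \<open>\<omega> \<mapsto> Q \<omega>\<close> be an admissible random variable of \<open>\<P>(Y)\<close>, say
  \<open>Q \<omega> = P2 (G \<omega>)\<close>. Evaluating the kernel \<open>K\<close> along \<open>(\<omega>, \<omega>') \<mapsto> G \<omega> \<omega>'\<close> and
  transporting along \<open>\<Omega> \<cong> \<Omega> \<times> \<Omega>\<close> gives an admissible random variable of \<open>\<P>(X)\<close> on \<open>\<Omega>\<close>,
  so that \<open>K \<omega> (G \<omega> \<omega>') = P1 (F (g (\<omega>, \<omega>')))\<close> with \<open>P1\<close> not depending on \<open>\<omega>, \<omega>'\<close>. The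
  product law of \<open>P1\<close> and \<open>P2\<close> is \<open>P (\<Phi>1, \<Phi>2)\<close> for some \<open>P\<close>, whence \<open>K \<omega> \<otimes> Q \<omega>\<close> is the
  push-forward of \<open>P\<close> along
  \<open>\<omega>'' \<mapsto> (F (g (\<omega>, \<Phi>2 \<omega>'')) (\<Phi>1 \<omega>''), G \<omega> (\<Phi>2 \<omega>''))\<close>, which is admissible in \<open>\<omega>\<close>.
\<close>

section \<open>Products and function spaces of quasi-measurable spaces\<close>

lemma points_qm_prod [simp]: "points (qm_prod Om X Y) = points X \<times> points Y"
  by (simp add: qm_prod_def)

lemma rvs_qm_prodI:
  "\<xi> \<in> rvs X \<Longrightarrow> \<eta> \<in> rvs Y \<Longrightarrow> (\<lambda>\<omega>\<in>points Om. (\<xi> \<omega>, \<eta> \<omega>)) \<in> rvs (qm_prod Om X Y)"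
  by (auto simp: qm_prod_def)

lemma rvs_qm_prodE:
  assumes "\<zeta> \<in> rvs (qm_prod Om X Y)"
  obtains \<xi> \<eta> where "\<xi> \<in> rvs X" "\<eta> \<in> rvs Y" "\<zeta> = (\<lambda>\<omega>\<in>points Om. (\<xi> \<omega>, \<eta> \<omega>))"
  using assms by (auto simp: qm_prod_def)

lemma points_qm_fun [simp]: "points (qm_fun Om X Y) = qm_maps Om X Y"
  by (simp add: qm_fun_def)

lemma qm_mapsD:
  "g \<in> qm_maps Om X Y \<Longrightarrow> \<xi> \<in> rvs X \<Longrightarrow> (\<lambda>\<omega>\<in>points Om. g (\<xi> \<omega>)) \<in> rvs Y"
  by (auto simp: qm_maps_def compose_def)

lemma rvs_in_points:
  "quasi_measurable_space Om X \<Longrightarrow> \<xi> \<in> rvs X \<Longrightarrow> \<omega> \<in> points Om \<Longrightarrow> \<xi> \<omega> \<in> points X"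
  using quasi_measurable_space.maps by blast

lemma rvs_extensional:
  "quasi_measurable_space Om X \<Longrightarrow> \<xi> \<in> rvs X \<Longrightarrow> \<xi> \<in> extensional (points Om)"
  by (drule quasi_measurable_space.maps) (simp add: PiE_def subset_iff)

context sample_space
begin

lemma quasi_measurable_space_self: "quasi_measurable_space Om Om"
  by unfold_locales (use maps const comp in auto)

lemma quasi_measurable_space_prod:
  assumes "quasi_measurable_space Om X" and "quasi_measurable_space Om Y"
  shows "quasi_measurable_space Om (qm_prod Om X Y)"
proof
  show "rvs (qm_prod Om X Y) \<subseteq> points Om \<rightarrow>\<^sub>E points (qm_prod Om X Y)"
    using rvs_in_points[OF assms(1)] rvs_in_points[OF assms(2)] by (auto elim!: rvs_qm_prodE)
next
  fix p assume p: "p \<in> points (qm_prod Om X Y)"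
  have "(\<lambda>\<omega>\<in>points Om. ((\<lambda>\<omega>\<in>points Om. fst p) \<omega>, (\<lambda>\<omega>\<in>points Om. snd p) \<omega>))
      \<in> rvs (qm_prod Om X Y)"
    using p assms by (intro rvs_qm_prodI quasi_measurable_space.const) auto
  then show "(\<lambda>\<omega>\<in>points Om. p) \<in> rvs (qm_prod Om X Y)"
    by (simp cong: restrict_cong)
next
  fix \<zeta> \<Phi> assume "\<zeta> \<in> rvs (qm_prod Om X Y)" and \<Phi>: "\<Phi> \<in> rvs Om"
  then obtain \<xi> \<eta> where *: "\<xi> \<in> rvs X" "\<eta> \<in> rvs Y" "\<zeta> = (\<lambda>\<omega>\<in>points Om. (\<xi> \<omega>, \<eta> \<omega>))"
    by (elim rvs_qm_prodE)
  have "compose (points Om) \<zeta> \<Phi> =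
      (\<lambda>\<omega>\<in>points Om. (compose (points Om) \<xi> \<Phi> \<omega>, compose (points Om) \<eta> \<Phi> \<omega>))"
    using rvs_in_points[OF quasi_measurable_space_self \<Phi>] by (auto simp: compose_def * fun_eq_iff)
  then show "compose (points Om) \<zeta> \<Phi> \<in> rvs (qm_prod Om X Y)"
    using * \<Phi> assms by (auto intro!: rvs_qm_prodI quasi_measurable_space.comp)
qed

text \<open>The constant at a point \<open>x\<close> of \<open>X\<close> is admissible, so
  \<open>g x\<close> is a value of an admissible random variable of \<open>Y\<close>, read off at
  some point of the non-empty \<open>\<Omega>\<close>. That \<open>g\<close> maps into
  \<open>points Y\<close> thus follows from the condition on random variables.\<close>

lemma qm_mapsI:
  assumes X: "quasi_measurable_space Om X" and Y: "quasi_measurable_space Om Y"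
    and ext: "g \<in> extensional (points X)"
    and rv: "\<And>\<xi>. \<xi> \<in> rvs X \<Longrightarrow> (\<lambda>\<omega>\<in>points Om. g (\<xi> \<omega>)) \<in> rvs Y"
  shows "g \<in> qm_maps Om X Y"
proof -
  have "g x \<in> points Y" if "x \<in> points X" for x
  proof -
    obtain \<omega> where \<omega>: "\<omega> \<in> points Om" using nonempty by blast
    have "(\<lambda>\<omega>\<in>points Om. g ((\<lambda>\<omega>\<in>points Om. x) \<omega>)) \<in> rvs Y"
      using rv[OF quasi_measurable_space.const[OF X that]] .
    from rvs_in_points[OF Y this \<omega>] \<omega> show ?thesis by simp
  qed
  with ext rv show ?thesis by (auto simp: qm_maps_def compose_def PiE_def)
qed

text \<open>Composing with the identity of \<open>\<Omega>\<close> turns a quasi-measurable map into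
  a random variable; closure under reparametrization gives the converse. The two readings of
  \<open>X\<^sup>\<Omega>\<close> therefore agree.\<close>

lemma qm_maps_self:
  assumes "quasi_measurable_space Om X"
  shows "qm_maps Om Om X = rvs X"
proof (intro equalityI subsetI)
  fix \<xi> assume \<xi>: "\<xi> \<in> qm_maps Om Om X"
  then have "\<xi> = (\<lambda>\<omega>\<in>points Om. \<xi> ((\<lambda>\<omega>\<in>points Om. \<omega>) \<omega>))"
    by (auto simp: qm_maps_def fun_eq_iff PiE_def extensional_def)
  with qm_mapsD[OF \<xi> ident] show "\<xi> \<in> rvs X" by simp
next
  fix \<xi> assume \<xi>: "\<xi> \<in> rvs X"
  have "\<xi> \<in> points Om \<rightarrow>\<^sub>E points X"
    using \<xi> quasi_measurable_space.maps[OF assms] by blast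
  then show "\<xi> \<in> qm_maps Om Om X"
    by (simp add: qm_maps_def quasi_measurable_space.comp[OF assms \<xi>])
qed

text \<open>The pair \<open>(\<Phi>, \<xi>)\<close> is an admissible random variable of the product
  of \<open>Om\<close> and \<open>X\<close>, and the uncurried \<open>F\<close> carries it into
  \<open>rvs Y\<close>. Together with \<open>rvs_qm_funI\<close> this replaces uncurrying by testing
  along pairs.\<close>

lemma rvs_qm_funD:
  assumes F: "F \<in> rvs (qm_fun Om X Y)" and \<Phi>: "\<Phi> \<in> rvs Om" and \<xi>: "\<xi> \<in> rvs X"
    and X: "quasi_measurable_space Om X"
  shows "(\<lambda>\<omega>\<in>points Om. F (\<Phi> \<omega>) (\<xi> \<omega>)) \<in> rvs Y"
proof -
  let ?G = "\<lambda>(\<omega>, x)\<in>points Om \<times> points X. F \<omega> x"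
  have "?G \<in> qm_maps Om (qm_prod Om Om X) Y"
    using F by (simp add: qm_fun_def)
  from qm_mapsD[OF this rvs_qm_prodI[OF \<Phi> \<xi>]]
  have "(\<lambda>\<omega>\<in>points Om. ?G ((\<lambda>\<omega>\<in>points Om. (\<Phi> \<omega>, \<xi> \<omega>)) \<omega>)) \<in> rvs Y" .
  also have "(\<lambda>\<omega>\<in>points Om. ?G ((\<lambda>\<omega>\<in>points Om. (\<Phi> \<omega>, \<xi> \<omega>)) \<omega>)) =
      (\<lambda>\<omega>\<in>points Om. F (\<Phi> \<omega>) (\<xi> \<omega>))"
    using rvs_in_points[OF quasi_measurable_space_self \<Phi>] rvs_in_points[OF X \<xi>]
    by (auto simp: fun_eq_iff)
  finally show ?thesis .
qed

text \<open>Every random variable of \<open>qm_prod Om Om X\<close> is a pair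
  \<open>(\<Phi>, \<xi>)\<close>, so \<open>rv\<close> tests the uncurried map on all of them; a
  constant \<open>\<Phi>\<close> yields quasi-measurability of each
  \<open>F \<omega>\<close>.\<close>

lemma rvs_qm_funI:
  assumes X: "quasi_measurable_space Om X" and Y: "quasi_measurable_space Om Y"
    and ext: "F \<in> extensional (points Om)"
      "\<And>\<omega>. \<omega> \<in> points Om \<Longrightarrow> F \<omega> \<in> extensional (points X)"
    and rv: "\<And>\<Phi> \<xi>. \<Phi> \<in> rvs Om \<Longrightarrow> \<xi> \<in> rvs X \<Longrightarrow> (\<lambda>\<omega>\<in>points Om. F (\<Phi> \<omega>) (\<xi> \<omega>)) \<in> rvs Y"
  shows "F \<in> rvs (qm_fun Om X Y)"
proof -
  have "F \<omega> \<in> qm_maps Om X Y" if \<omega>: "\<omega> \<in> points Om" for \<omega>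
  proof (rule qm_mapsI[OF X Y ext(2)[OF \<omega>]])
    fix \<xi> assume "\<xi> \<in> rvs X"
    from rv[OF const[OF \<omega>] this] show "(\<lambda>\<omega>'\<in>points Om. F \<omega> (\<xi> \<omega>')) \<in> rvs Y"
      by (simp cong: restrict_cong)
  qed
  moreover have "(\<lambda>(\<omega>, x)\<in>points Om \<times> points X. F \<omega> x) \<in> qm_maps Om (qm_prod Om Om X) Y"
  proof (rule qm_mapsI[OF quasi_measurable_space_prod[OF quasi_measurable_space_self X] Y])
    fix \<zeta> assume "\<zeta> \<in> rvs (qm_prod Om Om X)"
    then obtain \<Phi> \<xi> where *: "\<Phi> \<in> rvs Om" "\<xi> \<in> rvs X" "\<zeta> = (\<lambda>\<omega>\<in>points Om. (\<Phi> \<omega>, \<xi> \<omega>))"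
      by (elim rvs_qm_prodE)
    have "(\<lambda>\<omega>\<in>points Om. (\<lambda>(\<omega>, x)\<in>points Om \<times> points X. F \<omega> x) (\<zeta> \<omega>)) =
        (\<lambda>\<omega>\<in>points Om. F (\<Phi> \<omega>) (\<xi> \<omega>))"
      using rvs_in_points[OF quasi_measurable_space_self *(1)] rvs_in_points[OF X *(2)]
      by (auto simp: * fun_eq_iff)
    with rv[OF *(1,2)]
    show "(\<lambda>\<omega>\<in>points Om. (\<lambda>(\<omega>, x)\<in>points Om \<times> points X. F \<omega> x) (\<zeta> \<omega>)) \<in> rvs Y" by simp
  qed simp
  ultimately show ?thesis using ext(1) by (auto simp: qm_fun_def PiE_def)
qed

text \<open>Testing \<open>F \<circ> \<Phi>\<close> on \<open>(\<Psi>, \<xi>)\<close> is testing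
  \<open>F\<close> on \<open>(\<Phi> \<circ> \<Psi>, \<xi>)\<close>, which gives closure under
  reparametrization; the test of a constant \<open>g\<close> reduces to
  \<open>g \<circ> \<xi>\<close>.\<close>

lemma quasi_measurable_space_fun:
  assumes X: "quasi_measurable_space Om X" and Y: "quasi_measurable_space Om Y"
  shows "quasi_measurable_space Om (qm_fun Om X Y)"
proof
  show "rvs (qm_fun Om X Y) \<subseteq> points Om \<rightarrow>\<^sub>E points (qm_fun Om X Y)"
    by (auto simp: qm_fun_def)
next
  fix g assume "g \<in> points (qm_fun Om X Y)"
  then have g: "g \<in> qm_maps Om X Y" by simp
  show "(\<lambda>\<omega>\<in>points Om. g) \<in> rvs (qm_fun Om X Y)"
  proof (rule rvs_qm_funI[OF X Y])
    fix \<Phi> \<xi> assume \<Phi>: "\<Phi> \<in> rvs Om" and \<xi>: "\<xi> \<in> rvs X"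
    have "(\<lambda>\<omega>\<in>points Om. (\<lambda>\<omega>\<in>points Om. g) (\<Phi> \<omega>) (\<xi> \<omega>)) = (\<lambda>\<omega>\<in>points Om. g (\<xi> \<omega>))"
      using rvs_in_points[OF quasi_measurable_space_self \<Phi>] by (auto simp: fun_eq_iff)
    with qm_mapsD[OF g \<xi>]
    show "(\<lambda>\<omega>\<in>points Om. (\<lambda>\<omega>\<in>points Om. g) (\<Phi> \<omega>) (\<xi> \<omega>)) \<in> rvs Y" by simp
  qed (use g in \<open>auto simp: qm_maps_def PiE_def\<close>)
next
  fix F \<Phi> assume F: "F \<in> rvs (qm_fun Om X Y)" and \<Phi>: "\<Phi> \<in> rvs Om"
  show "compose (points Om) F \<Phi> \<in> rvs (qm_fun Om X Y)"
  proof (rule rvs_qm_funI[OF X Y])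
    fix \<Psi> \<xi> assume \<Psi>: "\<Psi> \<in> rvs Om" and \<xi>: "\<xi> \<in> rvs X"
    have "(\<lambda>\<omega>\<in>points Om. compose (points Om) F \<Phi> (\<Psi> \<omega>) (\<xi> \<omega>)) =
        (\<lambda>\<omega>\<in>points Om. F (compose (points Om) \<Phi> \<Psi> \<omega>) (\<xi> \<omega>))"
      using rvs_in_points[OF quasi_measurable_space_self \<Psi>] by (auto simp: fun_eq_iff compose_def)
    with rvs_qm_funD[OF F comp[OF \<Phi> \<Psi>] \<xi> X]
    show "(\<lambda>\<omega>\<in>points Om. compose (points Om) F \<Phi> (\<Psi> \<omega>) (\<xi> \<omega>)) \<in> rvs Y" by simp
  next
    fix \<omega> assume "\<omega> \<in> points Om"
    with rvs_in_points[OF quasi_measurable_space_self \<Phi>] F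
    have "F (\<Phi> \<omega>) \<in> qm_maps Om X Y" by (auto simp: qm_fun_def)
    then show "compose (points Om) F \<Phi> \<omega> \<in> extensional (points X)"
      using \<open>\<omega> \<in> points Om\<close> by (auto simp: compose_def qm_maps_def PiE_def)
  qed simp
qed

section \<open>Measurability for the induced sigma-algebras\<close>

lemma sets_qm_sigma_iff:
  assumes "quasi_measurable_space Om X"
  shows "A \<in> sets (qm_sigma B X) \<longleftrightarrow>
    A \<subseteq> points X \<and> (\<forall>\<xi>\<in>rvs X. \<xi> -` A \<inter> points Om \<in> sets B)"
  using sets_qm_sigma[of X B] quasi_measurable_space.maps[OF assms] space_B by simp

text \<open>\<open>qm_sigma B X\<close> is the final sigma-algebra for the admissible random
  variables, so a map out of it can be tested along each of them.\<close>

lemma measurable_qm_sigmaI: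
  assumes X: "quasi_measurable_space Om X" and f: "f \<in> points X \<rightarrow> space N"
    and rv: "\<And>\<xi>. \<xi> \<in> rvs X \<Longrightarrow> (\<lambda>\<omega>. f (\<xi> \<omega>)) \<in> measurable B N"
  shows "f \<in> measurable (qm_sigma B X) N"
proof (rule measurableI)
  fix A assume A: "A \<in> sets N"
  have "\<xi> -` (f -` A \<inter> points X) \<inter> points Om = (\<lambda>\<omega>. f (\<xi> \<omega>)) -` A \<inter> space B" if "\<xi> \<in> rvs X" for \<xi>
    using rvs_in_points[OF X that] by (auto simp: space_B)
  with rv A show "f -` A \<inter> space (qm_sigma B X) \<in> sets (qm_sigma B X)"
    by (auto simp: sets_qm_sigma_iff[OF X] space_qm_sigma intro: measurable_sets)
qed (use f in \<open>auto simp: space_qm_sigma\<close>)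

text \<open>Pairing \<open>\<xi>\<close> with the constant at \<open>y\<close> gives a random
  variable of the product; its preimage of \<open>D\<close> is the preimage of the section under
  \<open>\<xi>\<close>.\<close>

lemma section_in_qm_sigma:
  assumes X: "quasi_measurable_space Om X" and Y: "quasi_measurable_space Om Y"
    and D: "D \<in> sets (qm_sigma B (qm_prod Om X Y))" and y: "y \<in> points Y"
  shows "section_at D y \<in> sets (qm_sigma B X)"
proof -
  have *: "(\<lambda>\<omega>\<in>points Om. (\<xi> \<omega>, (\<lambda>\<omega>\<in>points Om. y) \<omega>)) -` D \<inter> points Om \<in> sets B"
    if "\<xi> \<in> rvs X" for \<xi>
    using D rvs_qm_prodI[OF that quasi_measurable_space.const[OF Y y]]
    by (auto simp: sets_qm_sigma_iff[OF quasi_measurable_space_prod[OF X Y]])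
  moreover have "(\<lambda>\<omega>\<in>points Om. (\<xi> \<omega>, (\<lambda>\<omega>\<in>points Om. y) \<omega>)) -` D \<inter> points Om =
      \<xi> -` section_at D y \<inter> points Om" for \<xi>
    by (auto simp: section_at_def)
  ultimately show ?thesis
    using D by (auto simp: sets_qm_sigma_iff[OF X] sets_qm_sigma_iff[OF quasi_measurable_space_prod[OF X Y]]
        section_at_def)
qed

text \<open>Pulling back along \<open>h\<close> and then along \<open>\<xi>\<close> is pulling back
  along \<open>h \<circ> \<xi>\<close>. The function \<open>h\<close> is restricted only after
  composition, so that explicit formulas can be inserted without making them extensional.\<close>

lemma vimage_in_qm_sigma:
  assumes X: "quasi_measurable_space Om X" and Y: "quasi_measurable_space Om Y"
    and rv: "\<And>\<xi>. \<xi> \<in> rvs X \<Longrightarrow> (\<lambda>\<omega>\<in>points Om. h (\<xi> \<omega>)) \<in> rvs Y"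
    and D: "D \<in> sets (qm_sigma B Y)"
  shows "{x\<in>points X. h x \<in> D} \<in> sets (qm_sigma B X)"
proof -
  have "\<xi> -` {x\<in>points X. h x \<in> D} \<inter> points Om = (\<lambda>\<omega>\<in>points Om. h (\<xi> \<omega>)) -` D \<inter> points Om"
    if "\<xi> \<in> rvs X" for \<xi>
    using rvs_in_points[OF X that] by auto
  with rv D show ?thesis by (auto simp: sets_qm_sigma_iff[OF X] sets_qm_sigma_iff[OF Y])
qed

end

section \<open>Push-forwards and the space of probability measures\<close>

context product_compatible
begin

lemma space_Ps: "P \<in> Ps \<Longrightarrow> space P = points Om"
  using prob by blast

text \<open>This is \<open>vimage_sets\<close> for the identity map, under which the preimage of
  \<open>A\<close> is \<open>A\<close> itself.\<close>

lemma sets_B_subset: "P \<in> Ps \<Longrightarrow> A \<in> sets B \<Longrightarrow> A \<in> sets P"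
proof -
  assume "P \<in> Ps" and A: "A \<in> sets B"
  then have "(\<lambda>\<omega>\<in>points Om. \<omega>) -` A \<inter> points Om \<in> sets P"
    by (intro vimage_sets ident)
  also have "(\<lambda>\<omega>\<in>points Om. \<omega>) -` A \<inter> points Om = A"
    using sets.sets_into_space[OF A] by (auto simp: space_B)
  finally show "A \<in> sets P" .
qed

text \<open>Preimages lie in \<open>sets B\<close> by definition of the induced sigma-algebra, hence
  in \<open>sets P\<close>. This makes \<open>distr P (qm_sigma B X) \<xi>\<close> a genuine
  push-forward, to which the library rules for \<open>emeasure\<close> and integrals apply.\<close>

lemma rvs_measurable:
  assumes X: "quasi_measurable_space Om X" and "\<xi> \<in> rvs X" and "P \<in> Ps"
  shows "\<xi> \<in> measurable P (qm_sigma B X)"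
proof (rule measurableI)
  fix A assume "A \<in> sets (qm_sigma B X)"
  with assms(2) have "\<xi> -` A \<inter> points Om \<in> sets B"
    by (simp add: sets_qm_sigma_iff[OF X])
  then show "\<xi> -` A \<inter> space P \<in> sets P"
    by (simp add: space_Ps sets_B_subset assms(3))
qed (use assms rvs_in_points[OF X] in \<open>auto simp: space_Ps space_qm_sigma\<close>)

lemma emeasure_distr_rv:
  assumes "quasi_measurable_space Om X" and "\<xi> \<in> rvs X" and "P \<in> Ps" and "A \<in> sets (qm_sigma B X)"
  shows "emeasure (distr P (qm_sigma B X) \<xi>) A = emeasure P {\<omega>\<in>points Om. \<xi> \<omega> \<in> A}"
proof -
  have "\<xi> -` A \<inter> space P = {\<omega>\<in>points Om. \<xi> \<omega> \<in> A}" using assms by (auto simp: space_Ps)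
  then show ?thesis by (simp add: emeasure_distr[OF rvs_measurable] assms)
qed

lemma rvs_qm_probE:
  assumes "\<mu> \<in> rvs (qm_prob Om B Ps X)"
  obtains P F where "P \<in> Ps" "F \<in> rvs (qm_fun Om Om X)"
    "\<mu> = (\<lambda>\<omega>\<in>points Om. distr P (qm_sigma B X) (F \<omega>))"
  using assms by (auto simp: qm_prob_def)

lemma rvs_qm_probI:
  "P \<in> Ps \<Longrightarrow> F \<in> rvs (qm_fun Om Om X) \<Longrightarrow>
    (\<lambda>\<omega>\<in>points Om. distr P (qm_sigma B X) (F \<omega>)) \<in> rvs (qm_prob Om B Ps X)"
  by (auto simp: qm_prob_def)

lemma rvs_qm_fun_self:
  assumes "quasi_measurable_space Om X" and "F \<in> rvs (qm_fun Om Om X)" and "\<omega> \<in> points Om"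
  shows "F \<omega> \<in> rvs X"
  using rvs_in_points[OF quasi_measurable_space_fun[OF quasi_measurable_space_self assms(1)] assms(2,3)]
  by (simp add: qm_maps_self[OF assms(1)])

text \<open>The measure \<open>P\<close> stays fixed and only the family \<open>F\<close> changes: a
  constant law comes from a constant family, and reparametrizing the law reparametrizes
  \<open>F\<close>. The closure properties are therefore inherited from
  \<open>(X\<^sup>\<Omega>)\<^sup>\<Omega>\<close>.\<close>

lemma quasi_measurable_space_prob:
  assumes X: "quasi_measurable_space Om X"
  shows "quasi_measurable_space Om (qm_prob Om B Ps X)"
proof
  note XO = quasi_measurable_space_fun[OF quasi_measurable_space_self X]
  show "rvs (qm_prob Om B Ps X) \<subseteq> points Om \<rightarrow>\<^sub>E points (qm_prob Om B Ps X)"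
    using rvs_qm_fun_self[OF X] by (fastforce simp: qm_prob_def)
  show "(\<lambda>\<omega>\<in>points Om. \<mu>) \<in> rvs (qm_prob Om B Ps X)"
    if "\<mu> \<in> points (qm_prob Om B Ps X)" for \<mu>
  proof -
    from that obtain P \<xi> where *: "P \<in> Ps" "\<xi> \<in> rvs X" "\<mu> = distr P (qm_sigma B X) \<xi>"
      by (auto simp: qm_prob_def)
    have "(\<lambda>\<omega>\<in>points Om. \<xi>) \<in> rvs (qm_fun Om Om X)"
      using * by (intro quasi_measurable_space.const[OF XO]) (simp add: qm_maps_self[OF X])
    from rvs_qm_probI[OF *(1) this] show ?thesis by (simp add: * cong: restrict_cong)
  qed
  show "compose (points Om) \<mu> \<Phi> \<in> rvs (qm_prob Om B Ps X)"
    if \<mu>: "\<mu> \<in> rvs (qm_prob Om B Ps X)" and \<Phi>: "\<Phi> \<in> rvs Om" for \<mu> \<Phi>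
  proof -
    from \<mu> obtain P F where *: "P \<in> Ps" "F \<in> rvs (qm_fun Om Om X)"
      "\<mu> = (\<lambda>\<omega>\<in>points Om. distr P (qm_sigma B X) (F \<omega>))"
      by (elim rvs_qm_probE)
    have "compose (points Om) \<mu> \<Phi> =
        (\<lambda>\<omega>\<in>points Om. distr P (qm_sigma B X) (compose (points Om) F \<Phi> \<omega>))"
      using rvs_in_points[OF quasi_measurable_space_self \<Phi>]
      by (auto simp: * fun_eq_iff compose_def)
    with rvs_qm_probI[OF *(1) quasi_measurable_space.comp[OF XO *(2) \<Phi>]] show ?thesis by simp
  qed
qed

section \<open>Measurability of the integrand\<close>

text \<open>Along \<open>\<eta>\<close> the kernel becomes
  \<open>\<omega> \<mapsto> P (F \<omega>)\<close> with a fixed \<open>P\<close>, so the function is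
  the measure under \<open>P\<close> of the sections of one set \<open>E\<close> in
  \<open>\<Omega> \<times> \<Omega>\<close>. Condition \<open>measurable_section\<close> applies to
  it.\<close>

lemma borel_measurable_section:
  assumes X: "quasi_measurable_space Om X" and Y: "quasi_measurable_space Om Y"
    and k: "\<And>\<eta>. \<eta> \<in> rvs Y \<Longrightarrow> (\<lambda>\<omega>\<in>points Om. k (\<eta> \<omega>)) \<in> rvs (qm_prob Om B Ps X)"
    and D: "D \<in> sets (qm_sigma B (qm_prod Om X Y))"
  shows "(\<lambda>y. emeasure (k y) (section_at D y)) \<in> borel_measurable (qm_sigma B Y)"
proof (rule measurable_qm_sigmaI[OF Y])
  fix \<eta> assume \<eta>: "\<eta> \<in> rvs Y"
  note O = quasi_measurable_space_self
  obtain P F where P: "P \<in> Ps" and F: "F \<in> rvs (qm_fun Om Om X)"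
    and eq: "(\<lambda>\<omega>\<in>points Om. k (\<eta> \<omega>)) = (\<lambda>\<omega>\<in>points Om. distr P (qm_sigma B X) (F \<omega>))"
    using rvs_qm_probE[OF k[OF \<eta>]] by blast
  \<comment> \<open>The first coordinate is the sample point of \<open>P\<close> and the second is
    the parameter, because \<open>section_at\<close> fixes the second.\<close>
  define E where "E = {p\<in>points (qm_prod Om Om Om). (F (snd p) (fst p), \<eta> (snd p)) \<in> D}"
  have "E \<in> sets (qm_sigma B (qm_prod Om Om Om))"
    unfolding E_def
  proof (rule vimage_in_qm_sigma[OF quasi_measurable_space_prod[OF O O] quasi_measurable_space_prod[OF X Y] _ D])
    fix \<zeta> assume "\<zeta> \<in> rvs (qm_prod Om Om Om)"
    then obtain \<Phi> \<Psi> where *: "\<Phi> \<in> rvs Om" "\<Psi> \<in> rvs Om" "\<zeta> = (\<lambda>\<omega>\<in>points Om. (\<Phi> \<omega>, \<Psi> \<omega>))"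
      by (elim rvs_qm_prodE)
    have "(\<lambda>\<omega>\<in>points Om. (F (snd (\<zeta> \<omega>)) (fst (\<zeta> \<omega>)), \<eta> (snd (\<zeta> \<omega>)))) =
        (\<lambda>\<omega>\<in>points Om. ((\<lambda>\<omega>\<in>points Om. F (\<Psi> \<omega>) (\<Phi> \<omega>)) \<omega>, compose (points Om) \<eta> \<Psi> \<omega>))"
      by (auto simp: * compose_def fun_eq_iff)
    with rvs_qm_prodI[OF rvs_qm_funD[OF F *(2,1) O] quasi_measurable_space.comp[OF Y \<eta> *(2)]]
    show "(\<lambda>\<omega>\<in>points Om. (F (snd (\<zeta> \<omega>)) (fst (\<zeta> \<omega>)), \<eta> (snd (\<zeta> \<omega>)))) \<in> rvs (qm_prod Om X Y)"
      by simp
  qed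
  from measurable_section[OF this P]
  have "(\<lambda>\<omega>. emeasure P (section_at E \<omega>)) \<in> borel_measurable B" .
  also have "?this \<longleftrightarrow> (\<lambda>\<omega>. emeasure (k (\<eta> \<omega>)) (section_at D (\<eta> \<omega>))) \<in> borel_measurable B"
  proof (rule measurable_cong)
    fix \<omega> assume "\<omega> \<in> space B"
    then have \<omega>: "\<omega> \<in> points Om" by (simp add: space_B)
    have "k (\<eta> \<omega>) = distr P (qm_sigma B X) (F \<omega>)"
      using fun_cong[OF eq, of \<omega>] \<omega> by simp
    then have "emeasure (k (\<eta> \<omega>)) (section_at D (\<eta> \<omega>)) =
        emeasure P {\<omega>'\<in>points Om. F \<omega> \<omega>' \<in> section_at D (\<eta> \<omega>)}"
      using emeasure_distr_rv[OF X rvs_qm_fun_self[OF X F \<omega>] P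
          section_in_qm_sigma[OF X Y D rvs_in_points[OF Y \<eta> \<omega>]]] by simp
    also have "{\<omega>'\<in>points Om. F \<omega> \<omega>' \<in> section_at D (\<eta> \<omega>)} = section_at E \<omega>"
      using \<omega> by (auto simp: E_def section_at_def)
    finally show "emeasure P (section_at E \<omega>) = emeasure (k (\<eta> \<omega>)) (section_at D (\<eta> \<omega>))" ..
  qed
  finally show "(\<lambda>\<omega>. emeasure (k (\<eta> \<omega>)) (section_at D (\<eta> \<omega>))) \<in> borel_measurable B" .
qed simp

section \<open>Representing the composite law by one measure\<close>

text \<open>Here \<open>q \<omega>\<close> stands for the law of \<open>Y\<close> and
  \<open>k \<omega> y\<close> for the law of \<open>X\<close> given \<open>y\<close>, both read
  along one random variable of \<open>Z\<close>. Since the kernels themselves may vary with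
  \<open>\<omega>\<close>, the result also serves for quasi-measurability in the kernels. The point
  is that a single \<open>P\<close> represents the composite law for all
  \<open>\<omega>\<close>.\<close>

lemma composite_law_representation:
  assumes iso: "qm_isomorphic Om Om (qm_prod Om Om Om)"
    and X: "quasi_measurable_space Om X" and Y: "quasi_measurable_space Om Y"
    and q: "(\<lambda>\<omega>\<in>points Om. q \<omega>) \<in> rvs (qm_prob Om B Ps Y)"
    and k: "\<And>\<Phi> \<eta>. \<Phi> \<in> rvs Om \<Longrightarrow> \<eta> \<in> rvs Y \<Longrightarrow>
      (\<lambda>\<omega>\<in>points Om. k (\<Phi> \<omega>) (\<eta> \<omega>)) \<in> rvs (qm_prob Om B Ps X)"
  obtains \<mu> where "\<mu> \<in> rvs (qm_prob Om B Ps (qm_prod Om X Y))"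
    and "\<And>\<omega> D. \<omega> \<in> points Om \<Longrightarrow> D \<in> sets (qm_sigma B (qm_prod Om X Y)) \<Longrightarrow>
      emeasure (\<mu> \<omega>) D = (\<integral>\<^sup>+y. emeasure (k \<omega> y) (section_at D y) \<partial>q \<omega>)"
proof -
  note O = quasi_measurable_space_self
  note OO = quasi_measurable_space_prod[OF O O]
  note XY = quasi_measurable_space_prod[OF X Y]
  obtain f g where f: "f \<in> qm_maps Om Om (qm_prod Om Om Om)"
    and g: "g \<in> qm_maps Om (qm_prod Om Om Om) Om"
    and fg: "\<And>p. p \<in> points Om \<times> points Om \<Longrightarrow> f (g p) = p"
    using iso by (auto simp: qm_isomorphic_def)
  \<comment> \<open>A quasi-measurable map out of \<open>\<Omega>\<close> is a random variable, so
    \<open>f\<close> splits into two maps in \<open>\<Omega>\<^sup>\<Omega>\<close>, the coordinates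
    that \<open>g\<close> inverts.\<close>
  have "f \<in> rvs (qm_prod Om Om Om)" using f by (simp add: qm_maps_self[OF OO])
  then obtain f1 f2 where f1: "f1 \<in> rvs Om" and f2: "f2 \<in> rvs Om"
    and f_eq: "f = (\<lambda>\<omega>\<in>points Om. (f1 \<omega>, f2 \<omega>))"
    by (elim rvs_qm_prodE)
  have g_in: "g (a, b) \<in> points Om" if "a \<in> points Om" "b \<in> points Om" for a b
    using g that by (auto simp: qm_maps_def)
  have f_g: "f1 (g (a, b)) = a" "f2 (g (a, b)) = b" if "a \<in> points Om" "b \<in> points Om" for a b
    using fg[of "(a, b)"] g_in[OF that] that by (auto simp: f_eq)
  have g_rv: "(\<lambda>\<omega>\<in>points Om. g (\<Phi> \<omega>, \<Psi> \<omega>)) \<in> rvs Om" if "\<Phi> \<in> rvs Om" "\<Psi> \<in> rvs Om" for \<Phi> \<Psi>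
    using qm_mapsD[OF g rvs_qm_prodI[OF that]] by (simp cong: restrict_cong)

  obtain P2 G where P2: "P2 \<in> Ps" and G: "G \<in> rvs (qm_fun Om Om Y)"
    and q_eq: "(\<lambda>\<omega>\<in>points Om. q \<omega>) = (\<lambda>\<omega>\<in>points Om. distr P2 (qm_sigma B Y) (G \<omega>))"
    using rvs_qm_probE[OF q] by blast
  \<comment> \<open>Each point of \<open>\<Omega>\<close> is read as a pair through
    \<open>(f1, f2)\<close>: \<open>f1\<close> gives the parameter and \<open>f2\<close> the sample
    fed to \<open>G\<close>. A random variable on \<open>\<Omega>\<close> thus encodes the
    two-parameter family, and one \<open>P1\<close> serves all pairs.\<close>
  obtain P1 F where P1: "P1 \<in> Ps" and F: "F \<in> rvs (qm_fun Om Om X)"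
    and k_eq: "(\<lambda>\<omega>\<in>points Om. k (f1 \<omega>) ((\<lambda>\<omega>\<in>points Om. G (f1 \<omega>) (f2 \<omega>)) \<omega>)) =
      (\<lambda>\<omega>\<in>points Om. distr P1 (qm_sigma B X) (F \<omega>))"
    using rvs_qm_probE[OF k[OF f1 rvs_qm_funD[OF G f1 f2 O]]] by blast
  have k_G: "k \<omega> (G \<omega> \<omega>') = distr P1 (qm_sigma B X) (F (g (\<omega>, \<omega>')))"
    if "\<omega> \<in> points Om" "\<omega>' \<in> points Om" for \<omega> \<omega>'
    using fun_cong[OF k_eq, of "g (\<omega>, \<omega>')"] g_in[OF that] f_g[OF that] by simp

  \<comment> \<open>Under \<open>P\<close>, \<open>\<Phi>1\<close> plays the role of the sample for
    \<open>P1\<close> and \<open>\<Phi>2\<close> that of the sample for \<open>P2\<close>.\<close>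
  obtain P \<Phi>1 \<Phi>2 where P: "P \<in> Ps" and \<Phi>1: "\<Phi>1 \<in> rvs Om" and \<Phi>2: "\<Phi>2 \<in> rvs Om"
    and prod: "\<And>D. D \<in> sets (qm_sigma B (qm_prod Om Om Om)) \<Longrightarrow>
      (\<integral>\<^sup>+\<omega>2. emeasure P1 (section_at D \<omega>2) \<partial>P2) = emeasure P {\<omega>\<in>points Om. (\<Phi>1 \<omega>, \<Phi>2 \<omega>) \<in> D}"
    using product[OF P1 P2] by blast
  \<comment> \<open>The second sample produces the value in \<open>Y\<close> and, through
    \<open>g\<close>, also selects the random variable of \<open>X\<close> that is evaluated at the
    first sample.\<close>
  define h where "h \<omega> p = (F (g (\<omega>, snd p)) (fst p), G \<omega> (snd p))" for \<omega> and p :: "'w \<times> 'w"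
  have h_rv: "(\<lambda>\<omega>\<in>points Om. h (\<Psi> \<omega>) (\<Phi> \<omega>, \<Phi>' \<omega>)) \<in> rvs (qm_prod Om X Y)"
    if "\<Psi> \<in> rvs Om" "\<Phi> \<in> rvs Om" "\<Phi>' \<in> rvs Om" for \<Psi> \<Phi> \<Phi>'
    using rvs_qm_prodI[OF rvs_qm_funD[OF F g_rv[OF that(1,3)] that(2) O] rvs_qm_funD[OF G that(1,3) O], where Om=Om]
    by (simp add: h_def cong: restrict_cong)
  define H where "H = (\<lambda>\<omega>\<in>points Om. \<lambda>\<omega>'\<in>points Om. h \<omega> (\<Phi>1 \<omega>', \<Phi>2 \<omega>'))"
  have H: "H \<in> rvs (qm_fun Om Om (qm_prod Om X Y))"
  proof (rule rvs_qm_funI[OF O XY])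
    fix \<Psi> \<Psi>' assume \<Psi>: "\<Psi> \<in> rvs Om" "\<Psi>' \<in> rvs Om"
    have "(\<lambda>\<omega>\<in>points Om. H (\<Psi> \<omega>) (\<Psi>' \<omega>)) = (\<lambda>\<omega>\<in>points Om.
        h (\<Psi> \<omega>) (compose (points Om) \<Phi>1 \<Psi>' \<omega>, compose (points Om) \<Phi>2 \<Psi>' \<omega>))"
      using rvs_in_points[OF O \<Psi>(1)] rvs_in_points[OF O \<Psi>(2)]
      by (auto simp: H_def compose_def fun_eq_iff)
    with h_rv[OF \<Psi>(1) comp[OF \<Phi>1 \<Psi>(2)] comp[OF \<Phi>2 \<Psi>(2)]]
    show "(\<lambda>\<omega>\<in>points Om. H (\<Psi> \<omega>) (\<Psi>' \<omega>)) \<in> rvs (qm_prod Om X Y)" by simp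
  qed (auto simp: H_def)

  show thesis
  proof (rule that[OF rvs_qm_probI[OF P H]])
    fix \<omega> D assume \<omega>: "\<omega> \<in> points Om" and D: "D \<in> sets (qm_sigma B (qm_prod Om X Y))"
    define E where "E = {p\<in>points (qm_prod Om Om Om). h \<omega> p \<in> D}"
    have E: "E \<in> sets (qm_sigma B (qm_prod Om Om Om))"
      unfolding E_def
    proof (rule vimage_in_qm_sigma[OF OO XY _ D])
      fix \<zeta> assume "\<zeta> \<in> rvs (qm_prod Om Om Om)"
      then obtain \<Phi> \<Psi> where *: "\<Phi> \<in> rvs Om" "\<Psi> \<in> rvs Om" "\<zeta> = (\<lambda>\<omega>\<in>points Om. (\<Phi> \<omega>, \<Psi> \<omega>))"
        by (elim rvs_qm_prodE)
      from h_rv[OF const[OF \<omega>] *(1,2)]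
      show "(\<lambda>\<omega>'\<in>points Om. h \<omega> (\<zeta> \<omega>')) \<in> rvs (qm_prod Om X Y)"
        by (simp add: * cong: restrict_cong)
    qed
    \<comment> \<open>The constant random variable at \<open>\<omega>\<close> freezes the parameter;
      the integrand is then measurable, as the change of variables along \<open>G \<omega>\<close>
      requires.\<close>
    have "(\<lambda>\<omega>'\<in>points Om. k \<omega> (\<eta> \<omega>')) \<in> rvs (qm_prob Om B Ps X)" if "\<eta> \<in> rvs Y" for \<eta>
      using k[OF const[OF \<omega>] that] by (simp cong: restrict_cong)
    note meas = borel_measurable_section[OF X Y this D]
    have G_\<omega>: "G \<omega> \<in> rvs Y" by (rule rvs_qm_fun_self[OF Y G \<omega>])
    have "q \<omega> = distr P2 (qm_sigma B Y) (G \<omega>)"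
      using fun_cong[OF q_eq, of \<omega>] \<omega> by simp
    then have "(\<integral>\<^sup>+y. emeasure (k \<omega> y) (section_at D y) \<partial>q \<omega>) =
        (\<integral>\<^sup>+\<omega>'. emeasure (k \<omega> (G \<omega> \<omega>')) (section_at D (G \<omega> \<omega>')) \<partial>P2)"
      using nn_integral_distr[OF rvs_measurable[OF Y G_\<omega> P2], of "\<lambda>y. emeasure (k \<omega> y) (section_at D y)"]
        meas by simp
    also have "\<dots> = (\<integral>\<^sup>+\<omega>'. emeasure P1 (section_at E \<omega>') \<partial>P2)"
    proof (rule nn_integral_cong)
      fix \<omega>' assume "\<omega>' \<in> space P2"
      then have \<omega>': "\<omega>' \<in> points Om" by (simp add: space_Ps P2)
      have "emeasure (k \<omega> (G \<omega> \<omega>')) (section_at D (G \<omega> \<omega>')) =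
          emeasure P1 {\<omega>''\<in>points Om. F (g (\<omega>, \<omega>')) \<omega>'' \<in> section_at D (G \<omega> \<omega>')}"
        unfolding k_G[OF \<omega> \<omega>']
        by (rule emeasure_distr_rv[OF X rvs_qm_fun_self[OF X F g_in[OF \<omega> \<omega>']] P1
              section_in_qm_sigma[OF X Y D rvs_in_points[OF Y G_\<omega> \<omega>']]])
      also have "{\<omega>''\<in>points Om. F (g (\<omega>, \<omega>')) \<omega>'' \<in> section_at D (G \<omega> \<omega>')} = section_at E \<omega>'"
        using \<omega>' by (auto simp: E_def h_def section_at_def)
      finally show "emeasure (k \<omega> (G \<omega> \<omega>')) (section_at D (G \<omega> \<omega>')) = emeasure P1 (section_at E \<omega>')" .
    qed
    also have "\<dots> = emeasure P {\<omega>'\<in>points Om. (\<Phi>1 \<omega>', \<Phi>2 \<omega>') \<in> E}"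
      by (rule prod[OF E])
    also have "{\<omega>'\<in>points Om. (\<Phi>1 \<omega>', \<Phi>2 \<omega>') \<in> E} = {\<omega>'\<in>points Om. H \<omega> \<omega>' \<in> D}"
      using \<omega> rvs_in_points[OF O \<Phi>1] rvs_in_points[OF O \<Phi>2] by (auto simp: E_def H_def)
    also have "emeasure P \<dots> = emeasure (distr P (qm_sigma B (qm_prod Om X Y)) (H \<omega>)) D"
      by (rule emeasure_distr_rv[OF XY rvs_qm_fun_self[OF XY H \<omega>] P D, symmetric])
    finally show "emeasure ((\<lambda>\<omega>\<in>points Om. distr P (qm_sigma B (qm_prod Om X Y)) (H \<omega>)) \<omega>) D =
        (\<integral>\<^sup>+y. emeasure (k \<omega> y) (section_at D y) \<partial>q \<omega>)"
      using \<omega> by simp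
  qed
qed

section \<open>The product of Markov kernels\<close>

text \<open>Both conclusions follow from identifying the kernel product pointwise with the
  admissible \<open>\<mu>\<close> of \<open>composite_law_representation\<close>. Letting
  \<open>K\<close>, \<open>Q\<close> and the point of \<open>Z\<close> vary with one
  \<open>\<omega>\<close> covers random kernels, and fixed ones through constants.\<close>

lemma kernel_prod_along_rv:
  assumes iso: "qm_isomorphic Om Om (qm_prod Om Om Om)"
    and X: "quasi_measurable_space Om X" and Y: "quasi_measurable_space Om Y"
    and Z: "quasi_measurable_space Om Z"
    and K: "K \<in> rvs (kernels Om B Ps X (qm_prod Om Y Z))"
    and Q: "Q \<in> rvs (kernels Om B Ps Y Z)" and \<zeta>: "\<zeta> \<in> rvs Z"
  shows kernel_prod_rv: "(\<lambda>\<omega>\<in>points Om. kernel_prod Om B X Y Z (K \<omega>) (Q \<omega>) (\<zeta> \<omega>))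
      \<in> rvs (qm_prob Om B Ps (qm_prod Om X Y))" (is ?rv)
    and emeasure_kernel_prod_rv: "\<And>\<omega> D. \<omega> \<in> points Om \<Longrightarrow> D \<in> sets (qm_sigma B (qm_prod Om X Y)) \<Longrightarrow>
      emeasure (kernel_prod Om B X Y Z (K \<omega>) (Q \<omega>) (\<zeta> \<omega>)) D = kernel_prod_val (K \<omega>) (Q \<omega>) (\<zeta> \<omega>) D"
proof -
  note O = quasi_measurable_space_self
  let ?M = "qm_sigma B (qm_prod Om X Y)"
  have q: "(\<lambda>\<omega>\<in>points Om. Q \<omega> (\<zeta> \<omega>)) \<in> rvs (qm_prob Om B Ps Y)"
    using rvs_qm_funD[OF Q[unfolded kernels_def] ident \<zeta> Z] by (simp cong: restrict_cong)
  have k: "(\<lambda>\<omega>\<in>points Om. K (\<Phi> \<omega>) (\<eta> \<omega>, \<zeta> (\<Phi> \<omega>))) \<in> rvs (qm_prob Om B Ps X)"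
    if \<Phi>: "\<Phi> \<in> rvs Om" and \<eta>: "\<eta> \<in> rvs Y" for \<Phi> \<eta>
    using rvs_qm_funD[OF K[unfolded kernels_def] \<Phi>
        rvs_qm_prodI[OF \<eta> quasi_measurable_space.comp[OF Z \<zeta> \<Phi>]] quasi_measurable_space_prod[OF Y Z]]
    by (simp add: compose_def cong: restrict_cong)
  obtain \<mu> where \<mu>: "\<mu> \<in> rvs (qm_prob Om B Ps (qm_prod Om X Y))"
    and em: "\<And>\<omega> D. \<omega> \<in> points Om \<Longrightarrow> D \<in> sets ?M \<Longrightarrow>
      emeasure (\<mu> \<omega>) D = (\<integral>\<^sup>+y. emeasure (K \<omega> (y, \<zeta> \<omega>)) (section_at D y) \<partial>Q \<omega> (\<zeta> \<omega>))"
    by (rule composite_law_representation[OF iso X Y q k]) auto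
  \<comment> \<open>The values \<open>kernel_prod_val\<close> agree with those of the measure
    \<open>\<mu> \<omega>\<close> on its sigma-algebra, so \<open>measure_of\<close> does not fall
    back to 0 but rebuilds \<open>\<mu> \<omega>\<close>.\<close>
  have eq: "kernel_prod Om B X Y Z (K \<omega>) (Q \<omega>) (\<zeta> \<omega>) = \<mu> \<omega>" if \<omega>: "\<omega> \<in> points Om" for \<omega>
  proof -
    have \<mu>_sets: "sets (\<mu> \<omega>) = sets ?M" "space (\<mu> \<omega>) = points X \<times> points Y"
      using \<mu> \<omega> by (auto elim!: rvs_qm_probE simp: space_qm_sigma)
    have "kernel_prod Om B X Y Z (K \<omega>) (Q \<omega>) (\<zeta> \<omega>) =
        measure_of (space (\<mu> \<omega>)) (sets (\<mu> \<omega>)) (kernel_prod_val (K \<omega>) (Q \<omega>) (\<zeta> \<omega>))"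
      using rvs_in_points[OF Z \<zeta> \<omega>] by (simp add: kernel_prod_def \<mu>_sets)
    also have "\<dots> = measure_of (space (\<mu> \<omega>)) (sets (\<mu> \<omega>)) (emeasure (\<mu> \<omega>))"
    proof (rule measure_of_eq[OF sets.space_closed])
      fix D assume "D \<in> sigma_sets (space (\<mu> \<omega>)) (sets (\<mu> \<omega>))"
      then have "D \<in> sets ?M" unfolding sets.sigma_sets_eq by (simp only: \<mu>_sets)
      with \<omega> show "kernel_prod_val (K \<omega>) (Q \<omega>) (\<zeta> \<omega>) D = emeasure (\<mu> \<omega>) D"
        by (simp add: em kernel_prod_val_def)
    qed
    finally show ?thesis by (simp add: measure_of_of_measure)
  qed
  show "emeasure (kernel_prod Om B X Y Z (K \<omega>) (Q \<omega>) (\<zeta> \<omega>)) D = kernel_prod_val (K \<omega>) (Q \<omega>) (\<zeta> \<omega>) D"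
    if "\<omega> \<in> points Om" "D \<in> sets ?M" for \<omega> D
    using that by (simp add: eq em kernel_prod_val_def)
  have "(\<lambda>\<omega>\<in>points Om. kernel_prod Om B X Y Z (K \<omega>) (Q \<omega>) (\<zeta> \<omega>)) = (\<lambda>\<omega>\<in>points Om. \<mu> \<omega>)"
    by (simp add: eq cong: restrict_cong)
  also have "\<dots> = \<mu>"
    using rvs_extensional[OF quasi_measurable_space_prob[OF quasi_measurable_space_prod[OF X Y]] \<mu>]
    by (rule extensional_restrict)
  finally show ?rv using \<mu> by simp
qed

lemma quasi_measurable_space_kernels:
  "quasi_measurable_space Om X \<Longrightarrow> quasi_measurable_space Om Z \<Longrightarrow>
    quasi_measurable_space Om (kernels Om B Ps X Z)"
  unfolding kernels_def by (intro quasi_measurable_space_fun quasi_measurable_space_prob)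

text \<open>A random pair of kernels gives a random variable of a function space, which is tested
  along \<open>(\<Phi>, \<zeta>)\<close>. Reparametrizing \<open>K\<close> and \<open>Q\<close> by
  \<open>\<Phi>\<close> makes both kernels and the point of \<open>Z\<close> depend on the same
  \<open>\<omega>\<close>, the case of \<open>kernel_prod_rv\<close>. That the products are again
  kernels comes from \<open>qm_mapsI\<close>.\<close>

lemma kernel_prod_qm_maps:
  assumes iso: "qm_isomorphic Om Om (qm_prod Om Om Om)"
    and X: "quasi_measurable_space Om X" and Y: "quasi_measurable_space Om Y"
    and Z: "quasi_measurable_space Om Z"
  shows "(\<lambda>(K, Q)\<in>points (kernels Om B Ps X (qm_prod Om Y Z)) \<times> points (kernels Om B Ps Y Z).
            kernel_prod Om B X Y Z K Q)
           \<in> qm_maps Om (qm_prod Om (kernels Om B Ps X (qm_prod Om Y Z)) (kernels Om B Ps Y Z))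
                (kernels Om B Ps (qm_prod Om X Y) Z)"
proof -
  note O = quasi_measurable_space_self
  note XY = quasi_measurable_space_prod[OF X Y]
  note KX = quasi_measurable_space_kernels[OF X quasi_measurable_space_prod[OF Y Z]]
  note KY = quasi_measurable_space_kernels[OF Y Z]
  let ?K = "kernels Om B Ps X (qm_prod Om Y Z)" and ?Q = "kernels Om B Ps Y Z"
  let ?prod = "\<lambda>(K, Q)\<in>points ?K \<times> points ?Q. kernel_prod Om B X Y Z K Q"
  show ?thesis
  proof (rule qm_mapsI[OF quasi_measurable_space_prod[OF KX KY] quasi_measurable_space_kernels[OF XY Z]])
    fix \<xi> assume "\<xi> \<in> rvs (qm_prod Om ?K ?Q)"
    then obtain K Q where K: "K \<in> rvs ?K" and Q: "Q \<in> rvs ?Q"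
      and \<xi>: "\<xi> = (\<lambda>\<omega>\<in>points Om. (K \<omega>, Q \<omega>))"
      by (elim rvs_qm_prodE)
    have "(\<lambda>\<omega>\<in>points Om. ?prod (\<xi> \<omega>)) = (\<lambda>\<omega>\<in>points Om. kernel_prod Om B X Y Z (K \<omega>) (Q \<omega>))"
      using rvs_in_points[OF KX K] rvs_in_points[OF KY Q] by (auto simp: \<xi> fun_eq_iff)
    also have "\<dots> \<in> rvs (kernels Om B Ps (qm_prod Om X Y) Z)"
      unfolding kernels_def
    proof (rule rvs_qm_funI[OF Z quasi_measurable_space_prob[OF XY]])
      fix \<Phi> \<zeta> assume \<Phi>: "\<Phi> \<in> rvs Om" and \<zeta>: "\<zeta> \<in> rvs Z"
      have "(\<lambda>\<omega>\<in>points Om. (\<lambda>\<omega>\<in>points Om. kernel_prod Om B X Y Z (K \<omega>) (Q \<omega>)) (\<Phi> \<omega>) (\<zeta> \<omega>)) =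
          (\<lambda>\<omega>\<in>points Om. kernel_prod Om B X Y Z
            (compose (points Om) K \<Phi> \<omega>) (compose (points Om) Q \<Phi> \<omega>) (\<zeta> \<omega>))"
        using rvs_in_points[OF O \<Phi>] by (auto simp: compose_def fun_eq_iff)
      with kernel_prod_rv[OF iso X Y Z quasi_measurable_space.comp[OF KX K \<Phi>]
          quasi_measurable_space.comp[OF KY Q \<Phi>] \<zeta>]
      show "(\<lambda>\<omega>\<in>points Om. (\<lambda>\<omega>\<in>points Om. kernel_prod Om B X Y Z (K \<omega>) (Q \<omega>)) (\<Phi> \<omega>) (\<zeta> \<omega>))
          \<in> rvs (qm_prob Om B Ps (qm_prod Om X Y))" by simp
    qed (auto simp: kernel_prod_def)
    finally show "(\<lambda>\<omega>\<in>points Om. ?prod (\<xi> \<omega>)) \<in> rvs (kernels Om B Ps (qm_prod Om X Y) Z)" .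
  qed simp
qed

text \<open>\<open>K\<close>, \<open>Q\<close> and \<open>z\<close> are regarded as constant random
  variables, and the formula along random variables is evaluated at any point of
  \<open>\<Omega>\<close>.\<close>

lemma emeasure_kernel_prod:
  assumes iso: "qm_isomorphic Om Om (qm_prod Om Om Om)"
    and X: "quasi_measurable_space Om X" and Y: "quasi_measurable_space Om Y"
    and Z: "quasi_measurable_space Om Z"
    and K: "K \<in> points (kernels Om B Ps X (qm_prod Om Y Z))"
    and Q: "Q \<in> points (kernels Om B Ps Y Z)" and z: "z \<in> points Z"
    and D: "D \<in> sets (qm_sigma B (qm_prod Om X Y))"
  shows "emeasure (kernel_prod Om B X Y Z K Q z) D = kernel_prod_val K Q z D"
proof -
  obtain \<omega> where "\<omega> \<in> points Om" using nonempty by blast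
  then show ?thesis
    using emeasure_kernel_prod_rv[OF iso X Y Z
        quasi_measurable_space.const[OF
          quasi_measurable_space_kernels[OF X quasi_measurable_space_prod[OF Y Z]] K]
        quasi_measurable_space.const[OF quasi_measurable_space_kernels[OF Y Z] Q]
        quasi_measurable_space.const[OF Z z] _ D]
    by simp
qed

text \<open>Pairing \<open>\<eta>\<close> with the constant at \<open>z\<close> shows that
  \<open>y \<mapsto> K (y, z)\<close> carries random variables of \<open>Y\<close> to admissible
  random laws.\<close>

lemma borel_measurable_kernel_section:
  assumes X: "quasi_measurable_space Om X" and Y: "quasi_measurable_space Om Y"
    and Z: "quasi_measurable_space Om Z"
    and K: "K \<in> points (kernels Om B Ps X (qm_prod Om Y Z))" and z: "z \<in> points Z"
    and D: "D \<in> sets (qm_sigma B (qm_prod Om X Y))"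
  shows "(\<lambda>y. emeasure (K (y, z)) (section_at D y)) \<in> borel_measurable (qm_sigma B Y)"
proof (rule borel_measurable_section[OF X Y _ D])
  fix \<eta> assume "\<eta> \<in> rvs Y"
  moreover have "K \<in> qm_maps Om (qm_prod Om Y Z) (qm_prob Om B Ps X)"
    using K by (simp add: kernels_def)
  ultimately show "(\<lambda>\<omega>\<in>points Om. K (\<eta> \<omega>, z)) \<in> rvs (qm_prob Om B Ps X)"
    using qm_mapsD[OF _ rvs_qm_prodI[OF _ quasi_measurable_space.const[OF Z z]]]
    by (fastforce cong: restrict_cong)
qed

end

text \<open>In HOL, \<open>emeasure\<close> and the integral are total, so measurability of the
  sections and of the integrand is asserted explicitly to make the integral formula meaningful.
  Membership in \<open>qm_maps\<close> contains both that products are kernels and that forming them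
  is quasi-measurable.\<close>

theorem theorem5p22:
  fixes Om :: "('w, 'w) qms" and B :: "'w measure" and Ps :: "'w measure set"
    and X :: "('w, 'x) qms" and Y :: "('w, 'y) qms" and Z :: "('w, 'z) qms"
  assumes "product_compatible Om B Ps"
    and "qm_isomorphic Om Om (qm_prod Om Om Om)"
    and "quasi_measurable_space Om X"
    and "quasi_measurable_space Om Y"
    and "quasi_measurable_space Om Z"
  shows "(\<forall>K\<in>points (kernels Om B Ps X (qm_prod Om Y Z)). \<forall>Q\<in>points (kernels Om B Ps Y Z).
            \<forall>z\<in>points Z. \<forall>D\<in>sets (qm_sigma B (qm_prod Om X Y)).
              (\<forall>y\<in>points Y. section_at D y \<in> sets (qm_sigma B X)) \<and>
              (\<lambda>y. emeasure (K (y, z)) (section_at D y)) \<in> borel_measurable (qm_sigma B Y) \<and>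
              emeasure (kernel_prod Om B X Y Z K Q z) D =
                (\<integral>\<^sup>+y. emeasure (K (y, z)) (section_at D y) \<partial>Q z)) \<and>
         (\<lambda>(K, Q)\<in>points (kernels Om B Ps X (qm_prod Om Y Z)) \<times> points (kernels Om B Ps Y Z).
            kernel_prod Om B X Y Z K Q)
           \<in> qm_maps Om (qm_prod Om (kernels Om B Ps X (qm_prod Om Y Z)) (kernels Om B Ps Y Z))
                (kernels Om B Ps (qm_prod Om X Y) Z)"
proof -
  interpret product_compatible Om B Ps by (rule assms(1))
  show ?thesis
  proof (intro conjI ballI)
    fix K Q z D
    assume K: "K \<in> points (kernels Om B Ps X (qm_prod Om Y Z))"
      and Q: "Q \<in> points (kernels Om B Ps Y Z)" and z: "z \<in> points Z"
      and D: "D \<in> sets (qm_sigma B (qm_prod Om X Y))"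
    show "section_at D y \<in> sets (qm_sigma B X)" if "y \<in> points Y" for y
      by (rule section_in_qm_sigma[OF assms(3,4) D that])
    show "(\<lambda>y. emeasure (K (y, z)) (section_at D y)) \<in> borel_measurable (qm_sigma B Y)"
      by (rule borel_measurable_kernel_section[OF assms(3-5) K z D])
    show "emeasure (kernel_prod Om B X Y Z K Q z) D =
        (\<integral>\<^sup>+y. emeasure (K (y, z)) (section_at D y) \<partial>Q z)"
      using emeasure_kernel_prod[OF assms(2-5) K Q z D] by (simp only: kernel_prod_val_def)
  qed (rule kernel_prod_qm_maps[OF assms(2-5)])
qed

end
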